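(* Let $X,Y$ be Banach spaces and let $\tau$ be one of the following topologies on $X$: the norm topology, the weak topology, or, provided that $X$ is a dual space, the weak$^*$ topology. Let $F$, $\Omega$, $y$, $\alpha$, $p\in[1,\infty)$, $(F_n)_{n\in\mathbb{N}}$, $(y_n)_{n\in\mathbb{N}}$, $(\alpha_n)_{n\in\mathbb{N}}$ satisfy all the standing assumptions listed in the context (relative to $\tau$), and assume $\alpha>0$. Assume in addition that for every $t\in\mathbb{R}$ the sublevel set $\{\Omega\le t\}=\{x\in X:\Omega(x)\le t\}$ is relatively countably compact in the topology $\tau$ (that is, its $\tau$-closure is countably compact). For $n\in\mathbb{N}$ and $x\in X$ let $$T_n(x)=\begin{cases}\frac1p\|F_n(x)-y_n\|_Y^p+\alpha_n\,\Omega(x), & x\in\operatorname{dom}(F_n),\\ +\infty, &\text{otherwise.}\end{cases}$$ Then $(T_n)_{n\in\mathbb{N}}$ is equi-coercive in the topology $\tau$.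
   Context: Standing assumptions. $X,Y$ are Banach spaces and $\tau$ is the norm topology, the weak topology or (if $X$ is a dual space) the weak$^*$ topology on $X$. (1) $F:\operatorname{dom}(F)\to Y$ is a (not necessarily linear) operator with $\emptyset\ne\operatorname{dom}(F)\subseteq X$, such that for every $z\in Y$ the function $X\to\mathbb{R}\cup\{+\infty\}$ given by $x\mapsto\|F(x)-z\|_Y$ if $x\in\operatorname{dom}(F)$ and $x\mapsto+\infty$ otherwise is $\tau$-lower semicontinuous on $X$ and norm upper semicontinuous on $\operatorname{dom}(F)$. (2) $\Omega:X\to\mathbb{R}\cup\{+\infty\}$ has effective domain $\operatorname{dom}(\Omega)=\{x\in X:\Omega(x)<\infty\}\supseteq\operatorname{dom}(F)$, and $\Omega$ is $\tau$-lower semicontinuous on $X$ and norm upper semicontinuous on $\operatorname{dom}(\Omega)$. (3) $y\in Y$, $\alpha\in[0,\infty)$, $p\in[1,\infty)$. (4) For each $n\in\mathbb{N}$, $F_n:\operatorname{dom}(F_n)\to Y$ is an operator with $\operatorname{dom}(F_n)\subseteq\operatorname{dom}(F)$; $\operatorname{dom}(F_n)\subseteq\operatorname{dom}(F_{n+1})$ for all $n$; and $\bigcup_{n}\operatorname{dom}(F_n)$ is norm dense in $\operatorname{dom}(F)$. (5) $(F_n)$ converges to $F$ locally uniformly with respect to $\tau$ on the $\tau$-closure $\overline{\operatorname{dom}(F)}^{\tau}$: for each $x\in\overline{\operatorname{dom}(F)}^{\tau}$ there is a $\tau$-open neighborhood $U$ of $x$ with $\lim_{n\to\infty}\sup_{x'\in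 U\cap\operatorname{dom}(F_n)}\|F_n(x')-F(x')\|_Y=0$ (the set $U\cap\operatorname{dom}(F_n)$ is nonempty for large $n$ by the density assumption). (6) $(y_n)$ is a sequence in $Y$ with $\|y_n-y\|_Y\to0$, and $(\alpha_n)$ is a sequence in $(0,\infty)$ converging to $\alpha$. "Upper semicontinuous on a subset $S$" refers to the restriction of the function to $S$. A subset of a topological space is countably compact if every countable open cover of it has a finite subcover. A sequence $(f_j)_{j\in\mathbb{N}}$ of functionals from a topological space $X$ into $[-\infty,+\infty]$ is equi-coercive if for every $t\in\mathbb{R}$ there is a closed countably compact set $K_t\subseteq X$ such that $\{x\in X: f_j(x)\le t\}\subseteq K_t$ for every $j\in\mathbb{N}$. *)

theory Defs
  imports "HOL-Analysis.Analysis"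
begin

definition initial_topology :: "('a \<Rightarrow> 'b::topological_space) set \<Rightarrow> 'a topology" where
  "initial_topology \<Phi> = topology_generated_by {f -` V |f V. f \<in> \<Phi> \<and> open V}"

definition weak_topology :: "'a::real_normed_vector topology" where
  "weak_topology = initial_topology {f::'a \<Rightarrow> real. bounded_linear f}"

(* "X is a dual space": J identifies X isometrically with the dual of the normed space 'z. *)
definition predual_iso :: "('a::real_normed_vector \<Rightarrow> ('z::real_normed_vector \<Rightarrow>\<^sub>L real)) \<Rightarrow> bool" where
  "predual_iso J \<longleftrightarrow> linear J \<and> surj J \<and> (\<forall>x. norm (J x) = norm x)"

(* The weak* topology depends on the chosen predual, hence on J. *)
definition weak_star_topology ::
    "('a::real_normed_vector \<Rightarrow> ('z::real_normed_vector \<Rightarrow>\<^sub>L real)) \<Rightarrow> 'a topology" where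
  "weak_star_topology J = initial_topology (range (\<lambda>z x. blinfun_apply (J x) z))"

definition lsc_map :: "'a topology \<Rightarrow> ('a \<Rightarrow> ereal) \<Rightarrow> bool" where
  "lsc_map T f \<longleftrightarrow> (\<forall>t. openin T {x \<in> topspace T. t < f x})"

definition usc_map :: "'a topology \<Rightarrow> ('a \<Rightarrow> ereal) \<Rightarrow> bool" where
  "usc_map T f \<longleftrightarrow> (\<forall>t. openin T {x \<in> topspace T. f x < t})"

definition countably_compactin :: "'a topology \<Rightarrow> 'a set \<Rightarrow> bool" where
  "countably_compactin T S \<longleftrightarrow> S \<subseteq> topspace T \<and>
     (\<forall>\<U>. countable \<U> \<and> (\<forall>U\<in>\<U>. openin T U) \<and> S \<subseteq> \<Union>\<U> \<longrightarrow>
        (\<exists>\<F>. finite \<F> \<and> \<F> \<subseteq> \<U> \<and> S \<subseteq> \<Union>\<F>))"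

definition relatively_countably_compactin :: "'a topology \<Rightarrow> 'a set \<Rightarrow> bool" where
  "relatively_countably_compactin T S \<longleftrightarrow> countably_compactin T (T closure_of S)"

definition equi_coercive :: "'a topology \<Rightarrow> (nat \<Rightarrow> 'a \<Rightarrow> ereal) \<Rightarrow> bool" where
  "equi_coercive T f \<longleftrightarrow>
     (\<forall>t::real. \<exists>K. closedin T K \<and> countably_compactin T K \<and>
        (\<forall>j. {x \<in> topspace T. f j x \<le> ereal t} \<subseteq> K))"

(* A partial operator is given by its domain D and a total function G; the values of G
   outside D are irrelevant in the following definitions. *)
definition residual :: "'a set \<Rightarrow> ('a \<Rightarrow> 'b::real_normed_vector) \<Rightarrow> 'b \<Rightarrow> 'a \<Rightarrow> ereal" where
  "residual D G z x = (if x \<in> D then ereal (norm (G x - z)) else \<infinity>)"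

definition tikhonov ::
    "real \<Rightarrow> 'a set \<Rightarrow> ('a \<Rightarrow> 'b::real_normed_vector) \<Rightarrow> 'b \<Rightarrow> real \<Rightarrow> ('a \<Rightarrow> ereal) \<Rightarrow> 'a \<Rightarrow> ereal" where
  "tikhonov p D G w a \<Omega> x =
     (if x \<in> D then ereal (1 / p * norm (G x - w) powr p) + ereal a * \<Omega> x else \<infinity>)"

(* The domains D n may miss U for finitely many n; the supremum over the empty set is then
   the bottom element of ereal, which does not affect the limit. *)
definition locally_uniform_conv_on ::
    "'a topology \<Rightarrow> 'a set \<Rightarrow> (nat \<Rightarrow> 'a set) \<Rightarrow> (nat \<Rightarrow> 'a \<Rightarrow> 'b::real_normed_vector) \<Rightarrow> ('a \<Rightarrow> 'b) \<Rightarrow> bool" where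
  "locally_uniform_conv_on T S D G F \<longleftrightarrow>
     (\<forall>x\<in>S. \<exists>U. openin T U \<and> x \<in> U \<and>
        (\<lambda>n. SUP x'\<in>U \<inter> D n. ereal (norm (G n x' - F x'))) \<longlonglongrightarrow> 0)"

end

theory Submission
  imports Defs
begin

text \<open>The data term is nonnegative, so a bound t on the n-th functional forces \<Omega> x
  \<le> t / \<alpha>n on the penalty alone (\<open>tikhonov_le_imp_penalty_le\<close>). Because
  \<alpha>n tends to \<alpha> > 0 through positive values, the reciprocals of the \<alpha>n are
  bounded by some C. Hence the t-sublevel sets of all the functionals lie in one sublevel set of
  \<Omega>, whose \<tau>-closure is countably compact by hypothesis and serves as the set K.\<close>

lemma tikhonov_le_imp_penalty_le:
  assumes "p \<ge> 0" "a > 0" "tikhonov p D G w a \<Omega> x \<le> ereal t"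
  shows "\<Omega> x \<le> ereal (t / a)"
proof -
  have nonneg: "0 \<le> 1 / p * norm (G x - w) powr p"
    using \<open>p \<ge> 0\<close> by simp
  have "ereal (1 / p * norm (G x - w) powr p) + ereal a * \<Omega> x \<le> ereal t"
    using assms(3) by (auto simp: tikhonov_def split: if_splits)
  then show ?thesis
    \<comment> \<open>If \<Omega> x were \<infinity>, then a > 0 would make the sum infinite,
      against the real bound t. The value -\<infinity> is trivial, and for a real value one drops
      the data term and divides by a.\<close>
    using nonneg \<open>a > 0\<close> by (cases "\<Omega> x") (auto simp: field_simps)
qed

theorem proposition3p8:
  fixes \<tau> :: "'a::banach topology"
    and J :: "'a \<Rightarrow> ('z::real_normed_vector \<Rightarrow>\<^sub>L real)"
    and domF :: "'a set" and F :: "'a \<Rightarrow> 'b::banach"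
    and \<Omega> :: "'a \<Rightarrow> ereal"
    and y :: 'b and \<alpha> p :: real
    and domFn :: "nat \<Rightarrow> 'a set" and Fn :: "nat \<Rightarrow> 'a \<Rightarrow> 'b"
    and yn :: "nat \<Rightarrow> 'b" and \<alpha>n :: "nat \<Rightarrow> real"
  assumes "\<tau> = euclidean \<or> \<tau> = weak_topology \<or> (predual_iso J \<and> \<tau> = weak_star_topology J)"
    and "domF \<noteq> {}"
    and "\<And>z. lsc_map \<tau> (residual domF F z)"
    and "\<And>z. usc_map (top_of_set domF) (residual domF F z)"
    and "\<And>x. \<Omega> x \<noteq> -\<infinity>"
    and "domF \<subseteq> {x. \<Omega> x < \<infinity>}"
    and "lsc_map \<tau> \<Omega>"
    and "usc_map (top_of_set {x. \<Omega> x < \<infinity>}) \<Omega>"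
    and "\<alpha> \<ge> 0" and "p \<ge> 1"
    and "\<And>n. domFn n \<subseteq> domF"
    and "\<And>n. domFn n \<subseteq> domFn (Suc n)"
    and "domF \<subseteq> closure (\<Union>n. domFn n)"
    and "locally_uniform_conv_on \<tau> (\<tau> closure_of domF) domFn Fn F"
    and "yn \<longlonglongrightarrow> y"
    and "\<And>n. \<alpha>n n > 0" and "\<alpha>n \<longlonglongrightarrow> \<alpha>"
    and "\<alpha> > 0"
    and "\<And>t::real. relatively_countably_compactin \<tau> {x. \<Omega> x \<le> ereal t}"
  shows "equi_coercive \<tau> (\<lambda>n. tikhonov p (domFn n) (Fn n) (yn n) (\<alpha>n n) \<Omega>)"
  unfolding equi_coercive_def
proof
  fix t :: real
  \<comment> \<open>A positive limit \<alpha> keeps the \<alpha>n away from 0; with limit 0 the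
    reciprocals would blow up.\<close>
  have "(\<lambda>n. inverse (\<alpha>n n)) \<longlonglongrightarrow> inverse \<alpha>"
    using assms(17,18) by (intro tendsto_inverse) auto
  then have "Bseq (\<lambda>n. inverse (\<alpha>n n))"
    by (intro convergent_imp_Bseq convergentI)
  then obtain C where C: "\<And>n. norm (inverse (\<alpha>n n)) \<le> C"
    unfolding Bseq_def by blast
  \<comment> \<open>The level does not depend on n. It uses the absolute value of t because \<Omega>
    may be negative: for t < 0 the bound C on the reciprocals would not give t / \<alpha>n \<le> t *
    C.\<close>
  define S where "S = {x. \<Omega> x \<le> ereal (\<bar>t\<bar> * C)}"
  have "x \<in> S" if "tikhonov p (domFn n) (Fn n) (yn n) (\<alpha>n n) \<Omega> x \<le> ereal t" for n x
  proof -
    have "t / \<alpha>n n \<le> \<bar>t\<bar> * norm (inverse (\<alpha>n n))"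
      by (metis abs_ge_self abs_mult divide_inverse real_norm_def)
    also have "\<dots> \<le> \<bar>t\<bar> * C"
      by (intro mult_left_mono C) simp
    finally have "t / \<alpha>n n \<le> \<bar>t\<bar> * C" .
    moreover have "\<Omega> x \<le> ereal (t / \<alpha>n n)"
      using tikhonov_le_imp_penalty_le[OF _ assms(16) that] assms(10) by simp
    ultimately show ?thesis
      unfolding S_def by (simp add: order_trans)
  qed
  \<comment> \<open>Intersecting with \<open>topspace \<tau>\<close> gives the inclusion into the
    closure for each choice of \<tau> at once, without computing its underlying set.\<close>
  then have "{x \<in> topspace \<tau>. tikhonov p (domFn n) (Fn n) (yn n) (\<alpha>n n) \<Omega> x \<le> ereal t}
      \<subseteq> \<tau> closure_of S" for n
    using closure_of_subset_Int[of \<tau> S] by blast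
  moreover have "countably_compactin \<tau> (\<tau> closure_of S)"
    using assms(19) unfolding S_def relatively_countably_compactin_def by blast
  ultimately show "\<exists>K. closedin \<tau> K \<and> countably_compactin \<tau> K \<and>
      (\<forall>n. {x \<in> topspace \<tau>. tikhonov p (domFn n) (Fn n) (yn n) (\<alpha>n n) \<Omega> x \<le> ereal t} \<subseteq> K)"
    using closedin_closure_of by blast
qed

end
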